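(* Let $K\subseteq k((G))$ be a Hahn field with the first lifting property and the canonical second lifting property. Then \begin{align*} v\text{-}\mathrm{Aut}\,K &\simeq \big(1\text{-}\mathrm{Aut}\,K\rtimes \mathrm{Hom}(G,k^\times)\big)\rtimes(\mathrm{Aut}\,k\times o\text{-}\mathrm{Aut}\,G),\\ v\text{-}\mathrm{Aut}_kK &\simeq \big(1\text{-}\mathrm{Aut}_kK\rtimes \mathrm{Hom}(G,k^\times)\big)\rtimes o\text{-}\mathrm{Aut}\,G. \end{align*}
   Context: Let $k$ be a field and $(G,+,<)$ a totally ordered abelian group. $\mathbb K=k((G))$ is the field of all formal series $a=\sum_{g\in G}a_gt^g$ ($a_g\in k$) whose support $\operatorname{supp}a=\{g:a_g\neq 0\}$ is well ordered, with termwise addition and convolution product. $k(G)\subseteq\mathbb K$ is the fraction field of the group ring $k[G]$ (series with finite support). A Hahn field is a field $K$ with $k(G)\subseteq K\subseteq \mathbb K$. It carries the valuation $v(a)=\min\operatorname{supp}a$ for $a\neq0$, $v(0)=\infty$, with value group $G$. $\mathrm{Aut}\,k$ is the group of field automorphisms of $k$; $o\text{-}\mathrm{Aut}\,G$ is the group of order preserving automorphisms of $G$. $v\text{-}\mathrm{Aut}\,K$ is the group of valuation preserving automorphisms: field automorphisms $\sigma$ of $K$ for which there is $\tau\in o\text{-}\mathrm{Aut}\,G$ with $\tau(v(a))=v(\sigma(a))$ for all $a\in K^\times$. For any group of automorphisms of $K$, the subscript $(k)$ denotes the subgroup of those $\sigma$ with $\sigma(k)=k$, and the subscript $k$ the subgroup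 of those $\sigma$ with $\sigma|_k=\mathrm{id}_k$. For $\sigma\in v\text{-}\mathrm{Aut}\,K$ let $\sigma_G\in o\text{-}\mathrm{Aut}\,G$, $\sigma_G(v(a))=v(\sigma(a))$, and $\sigma_k\in\mathrm{Aut}\,k$, $\sigma_k(c)=\sigma(c)_0$ (constant term) for $c\in k$. This gives a group homomorphism $\Phi\colon v\text{-}\mathrm{Aut}\,K\to\mathrm{Aut}\,k\times o\text{-}\mathrm{Aut}\,G$, $\sigma\mapsto(\sigma_k,\sigma_G)$. Put $\mathrm{IntAut}\,K:=\ker\Phi$. $K$ has the first lifting property if there is a section of $\Phi$, i.e. an injective group homomorphism $\Psi\colon \mathrm{Aut}\,k\times o\text{-}\mathrm{Aut}\,G\to v\text{-}\mathrm{Aut}\,K$ with $\Phi\Psi=\mathrm{id}$; such a $\Psi$ is fixed and $\mathrm{ExtAut}\,K:=\operatorname{im}\Psi$. Convention: if the maps $\sum a_gt^g\mapsto\sum\rho(a_g)t^{\tau(g)}$ send $K$ onto $K$ for all $(\rho,\tau)$ (canonical first lifting property), then $\Psi$ is chosen to be the section $\Psi_c$ assigning to $(\rho,\tau)$ this map restricted to $K$. $\mathrm{Hom}(G,k^\times)$ is the group, under pointwise multiplication, of homomorphisms $x\colon(G,+)\to(k^\times,\cdot)$, $x^g:=x(g)$. $K$ has the canonical second lifting property if $x\mapsto\rho_x$, $\rho_x(\sum a_gt^g)=\sum a_gx^gt^g$, is a well defined group homomorphism $\mathrm{Hom}(G,k^\times)\to\mathrm{IntAut}\,K$. The group of 1-automorphisms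 is $1\text{-}\mathrm{Aut}\,K:=\{\sigma\in\mathrm{IntAut}\,K:\sigma(t^g)_g=1\text{ for all }g\in G\}$ (where $a_g$ denotes the coefficient of $t^g$ in $a$). Semi-direct products are written with the normal factor on the left; the actions are those induced by conjugation of automorphisms, via the identifications $x\mapsto\rho_x$ and $\mathrm{ExtAut}\,K\simeq\mathrm{Aut}\,k\times o\text{-}\mathrm{Aut}\,G$ (respectively $\mathrm{ExtAut}_kK\simeq o\text{-}\mathrm{Aut}\,G$).
   Formalization: The second isomorphism is stated under the added condition that τ ↦ Ψ(id,τ) is an isomorphism of o-Aut G onto ExtAut_k K; this holds for the canonical section, but fails for some other sections, where the formula can be false. *)

theory Defs
  imports "HOL-Algebra.Bij" "HOL-Algebra.QuotRing"
begin

section \<open>Hahn series and Hahn fields\<close>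

definition supp :: "('g \<Rightarrow> 'k::zero) \<Rightarrow> 'g set"
  where "supp a = {g. a g \<noteq> 0}"

text \<open>
  For well-ordered supports only finitely many \<open>h\<close> contribute to a coefficient of the
  product, so the sum below is the genuine convolution.
\<close>
definition conv :: "('g::ab_group_add \<Rightarrow> 'k::field) \<Rightarrow> ('g \<Rightarrow> 'k) \<Rightarrow> 'g \<Rightarrow> 'k"
  where "conv a b = (\<lambda>g. \<Sum>h | h \<in> supp a \<and> g - h \<in> supp b. a h * b (g - h))"

definition monomial :: "'k::zero \<Rightarrow> 'g \<Rightarrow> 'g \<Rightarrow> 'k"
  where "monomial c g = (\<lambda>h. if h = g then c else 0)"

text \<open>The embedding of the coefficient field, and the monomials \<open>t\<^sup>g\<close>.\<close>

abbreviation const :: "'k::zero \<Rightarrow> 'g::zero \<Rightarrow> 'k"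
  where "const c \<equiv> monomial c 0"

abbreviation tpow :: "'g \<Rightarrow> 'g \<Rightarrow> 'k::zero_neq_one"
  where "tpow g \<equiv> monomial 1 g"

definition hahn_ring :: "('g::linordered_ab_group_add \<Rightarrow> 'k::field) ring"
  where "hahn_ring =
    \<lparr>carrier = {a. wfp_on (supp a) (<)}, mult = conv, one = const 1,
     zero = (\<lambda>_. 0), add = (\<lambda>a b g. a g + b g)\<rparr>"

definition group_algebra :: "('g::linordered_ab_group_add \<Rightarrow> 'k::field) set"
  where "group_algebra = {a. finite (supp a)}"

definition fraction_series :: "('g::linordered_ab_group_add \<Rightarrow> 'k::field) set"
  where "fraction_series =
    {a \<in> carrier hahn_ring. \<exists>p \<in> group_algebra. \<exists>q \<in> group_algebra - {\<lambda>_. 0}. conv a q = p}"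

abbreviation restricted :: "('g::linordered_ab_group_add \<Rightarrow> 'k::field) set \<Rightarrow> ('g \<Rightarrow> 'k) ring"
  where "restricted K \<equiv> hahn_ring\<lparr>carrier := K\<rparr>"

definition hahn_field :: "('g::linordered_ab_group_add \<Rightarrow> 'k::field) set \<Rightarrow> bool"
  where "hahn_field K \<longleftrightarrow>
    fraction_series \<subseteq> K \<and> K \<subseteq> carrier hahn_ring \<and> Ring.field (restricted K)"

text \<open>Only meaningful on nonzero series; the value \<open>\<infinity>\<close> at zero is never needed.\<close>
definition val :: "('g::linorder \<Rightarrow> 'k::zero) \<Rightarrow> 'g"
  where "val a = (LEAST g. g \<in> supp a)"


section \<open>Groups of automorphisms\<close>

definition field_Aut :: "('k::field \<Rightarrow> 'k) monoid"
  where "field_Aut = BijGroup UNIV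
    \<lparr>carrier := {\<rho>. bij \<rho> \<and> \<rho> 1 = 1 \<and>
       (\<forall>c d. \<rho> (c + d) = \<rho> c + \<rho> d \<and> \<rho> (c * d) = \<rho> c * \<rho> d)}\<rparr>"

definition ord_Aut :: "('g::linordered_ab_group_add \<Rightarrow> 'g) monoid"
  where "ord_Aut = BijGroup UNIV
    \<lparr>carrier := {\<tau>. bij \<tau> \<and> mono \<tau> \<and> (\<forall>g h. \<tau> (g + h) = \<tau> g + \<tau> h)}\<rparr>"

text \<open>\<open>Hom (G, k\<^sup>\<times>)\<close>\<close>
definition char_group :: "('g::linordered_ab_group_add \<Rightarrow> 'k::field) monoid"
  where "char_group =
    \<lparr>carrier = {x. (\<forall>g. x g \<noteq> 0) \<and> (\<forall>g h. x (g + h) = x g * x h)},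
     mult = (\<lambda>x y g. x g * y g), one = (\<lambda>_. 1)\<rparr>"

definition v_Aut ::
  "('g::linordered_ab_group_add \<Rightarrow> 'k::field) set \<Rightarrow> (('g \<Rightarrow> 'k) \<Rightarrow> 'g \<Rightarrow> 'k) monoid"
  where "v_Aut K = BijGroup K
    \<lparr>carrier := {\<sigma> \<in> Bij K \<inter> ring_iso (restricted K) (restricted K).
       \<exists>\<tau> \<in> carrier ord_Aut. \<forall>a \<in> K - {\<lambda>_. 0}. \<tau> (val a) = val (\<sigma> a)}\<rparr>"

definition group_part ::
  "('g::linordered_ab_group_add \<Rightarrow> 'k::field) set \<Rightarrow> (('g \<Rightarrow> 'k) \<Rightarrow> 'g \<Rightarrow> 'k) \<Rightarrow> 'g \<Rightarrow> 'g"
  where "group_part K \<sigma> =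
    (THE \<tau>. \<tau> \<in> carrier ord_Aut \<and> (\<forall>a \<in> K - {\<lambda>_. 0}. \<tau> (val a) = val (\<sigma> a)))"

definition coeff_part :: "(('g::zero \<Rightarrow> 'k::zero) \<Rightarrow> 'g \<Rightarrow> 'k) \<Rightarrow> 'k \<Rightarrow> 'k"
  where "coeff_part \<sigma> = (\<lambda>c. \<sigma> (const c) 0)"

definition Phi ::
  "('g::linordered_ab_group_add \<Rightarrow> 'k::field) set \<Rightarrow>
    (('g \<Rightarrow> 'k) \<Rightarrow> 'g \<Rightarrow> 'k) \<Rightarrow> ('k \<Rightarrow> 'k) \<times> ('g \<Rightarrow> 'g)"
  where "Phi K \<sigma> = (coeff_part \<sigma>, group_part K \<sigma>)"

definition int_Aut ::
  "('g::linordered_ab_group_add \<Rightarrow> 'k::field) set \<Rightarrow> (('g \<Rightarrow> 'k) \<Rightarrow> 'g \<Rightarrow> 'k) monoid"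
  where "int_Aut K = (v_Aut K)\<lparr>carrier := kernel (v_Aut K) (field_Aut \<times>\<times> ord_Aut) (Phi K)\<rparr>"

definition one_Aut ::
  "('g::linordered_ab_group_add \<Rightarrow> 'k::field) set \<Rightarrow> (('g \<Rightarrow> 'k) \<Rightarrow> 'g \<Rightarrow> 'k) monoid"
  where "one_Aut K = (v_Aut K)
    \<lparr>carrier := {\<sigma> \<in> carrier (int_Aut K). \<forall>g. \<sigma> (tpow g) g = 1}\<rparr>"

text \<open>The subscript \<open>k\<close>: the automorphisms in a given group that are the identity on \<open>k\<close>.\<close>
definition fix_coeffs ::
  "(('g::zero \<Rightarrow> 'k::zero) \<Rightarrow> 'g \<Rightarrow> 'k) monoid \<Rightarrow> (('g \<Rightarrow> 'k) \<Rightarrow> 'g \<Rightarrow> 'k) monoid"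
  where "fix_coeffs A = A\<lparr>carrier := {\<sigma> \<in> carrier A. \<forall>c. \<sigma> (const c) = const c}\<rparr>"


section \<open>Lifting properties\<close>

type_synonym ('g, 'k) section_map =
  "('k \<Rightarrow> 'k) \<times> ('g \<Rightarrow> 'g) \<Rightarrow> ('g \<Rightarrow> 'k) \<Rightarrow> 'g \<Rightarrow> 'k"

definition lifting_section ::
  "('g::linordered_ab_group_add \<Rightarrow> 'k::field) set \<Rightarrow> ('g, 'k) section_map \<Rightarrow> bool"
  where "lifting_section K \<Psi> \<longleftrightarrow>
    \<Psi> \<in> hom (field_Aut \<times>\<times> ord_Aut) (v_Aut K) \<and>
    inj_on \<Psi> (carrier (field_Aut \<times>\<times> ord_Aut)) \<and>
    (\<forall>p \<in> carrier (field_Aut \<times>\<times> ord_Aut). Phi K (\<Psi> p) = p)"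

text \<open>The map \<open>\<Sum> a\<^sub>g t\<^sup>g \<mapsto> \<Sum> \<rho>(a\<^sub>g) t\<^bsup>\<tau>(g)\<^esup>\<close>.\<close>
definition canonical_map :: "('g, 'k) section_map"
  where "canonical_map = (\<lambda>(\<rho>, \<tau>) a g. \<rho> (a (inv_into UNIV \<tau> g)))"

definition canonical_first_lifting ::
  "('g::linordered_ab_group_add \<Rightarrow> 'k::field) set \<Rightarrow> bool"
  where "canonical_first_lifting K \<longleftrightarrow>
    (\<forall>p \<in> carrier (field_Aut \<times>\<times> ord_Aut). canonical_map p ` K = K)"

text \<open>
  An admissible choice of section: the canonical one is taken whenever it is available.
  The first lifting property of \<open>K\<close> is the existence of a \<open>lifting_section\<close>.
\<close>
definition chosen_section ::
  "('g::linordered_ab_group_add \<Rightarrow> 'k::field) set \<Rightarrow> ('g, 'k) section_map \<Rightarrow> bool"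
  where "chosen_section K \<Psi> \<longleftrightarrow>
    lifting_section K \<Psi> \<and>
    (canonical_first_lifting K \<longrightarrow>
      (\<forall>p \<in> carrier (field_Aut \<times>\<times> ord_Aut). \<Psi> p = restrict (canonical_map p) K))"

definition ext_Aut ::
  "('g::linordered_ab_group_add \<Rightarrow> 'k::field) set \<Rightarrow> ('g, 'k) section_map \<Rightarrow>
    (('g \<Rightarrow> 'k) \<Rightarrow> 'g \<Rightarrow> 'k) monoid"
  where "ext_Aut K \<Psi> = (v_Aut K)\<lparr>carrier := \<Psi> ` carrier (field_Aut \<times>\<times> ord_Aut)\<rparr>"

definition char_map ::
  "('g \<Rightarrow> 'k::times) set \<Rightarrow> ('g \<Rightarrow> 'k) \<Rightarrow> ('g \<Rightarrow> 'k) \<Rightarrow> 'g \<Rightarrow> 'k"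
  where "char_map K x = (\<lambda>a \<in> K. \<lambda>g. a g * x g)"

definition canonical_second_lifting ::
  "('g::linordered_ab_group_add \<Rightarrow> 'k::field) set \<Rightarrow> bool"
  where "canonical_second_lifting K \<longleftrightarrow> char_map K \<in> hom char_group (int_Aut K)"

text \<open>
  \<open>\<tau> \<mapsto> \<Psi> (id, \<tau>)\<close> is an isomorphism of \<open>o-Aut G\<close> onto \<open>ExtAut\<^sub>k K\<close>. Being a section,
  \<open>\<Psi>\<close> only guarantees that \<open>\<Psi> (id, \<tau>)\<close> is the identity on \<open>k\<close> modulo terms of positive
  value, so for a noncanonical \<open>\<Psi>\<close> this is a genuine condition.
\<close>
definition identifies_ext_k ::
  "('g::linordered_ab_group_add \<Rightarrow> 'k::field) set \<Rightarrow> ('g, 'k) section_map \<Rightarrow> bool"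
  where "identifies_ext_k K \<Psi> \<longleftrightarrow>
    (\<lambda>\<tau>. \<Psi> (id, \<tau>)) \<in> iso ord_Aut (fix_coeffs (ext_Aut K \<Psi>))"


section \<open>Semidirect products\<close>

definition semidirect ::
  "('a, 'm) monoid_scheme \<Rightarrow> ('b, 'n) monoid_scheme \<Rightarrow> ('b \<Rightarrow> 'a \<Rightarrow> 'a) \<Rightarrow> ('a \<times> 'b) monoid"
  where "semidirect N H act =
    \<lparr>carrier = carrier N \<times> carrier H,
     mult = (\<lambda>(n, h) (n', h'). (n \<otimes>\<^bsub>N\<^esub> act h n', h \<otimes>\<^bsub>H\<^esub> h')),
     one = (\<one>\<^bsub>N\<^esub>, \<one>\<^bsub>H\<^esub>)\<rparr>"

definition conj_by ::
  "('g::linordered_ab_group_add \<Rightarrow> 'k::field) set \<Rightarrow> (('g \<Rightarrow> 'k) \<Rightarrow> 'g \<Rightarrow> 'k) \<Rightarrow>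
    (('g \<Rightarrow> 'k) \<Rightarrow> 'g \<Rightarrow> 'k) \<Rightarrow> ('g \<Rightarrow> 'k) \<Rightarrow> 'g \<Rightarrow> 'k"
  where "conj_by K \<phi> \<sigma> = \<phi> \<otimes>\<^bsub>v_Aut K\<^esub> \<sigma> \<otimes>\<^bsub>v_Aut K\<^esub> inv\<^bsub>v_Aut K\<^esub> \<phi>"

text \<open>
  \<open>N\<close> is \<open>1-Aut K\<close> or \<open>1-Aut\<^sub>k K\<close>; \<open>Hom (G, k\<^sup>\<times>)\<close> acts by conjugation with \<open>\<rho>\<^sub>x\<close>.
\<close>
definition int_semidirect ::
  "('g::linordered_ab_group_add \<Rightarrow> 'k::field) set \<Rightarrow> (('g \<Rightarrow> 'k) \<Rightarrow> 'g \<Rightarrow> 'k) monoid \<Rightarrow>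
    ((('g \<Rightarrow> 'k) \<Rightarrow> 'g \<Rightarrow> 'k) \<times> ('g \<Rightarrow> 'k)) monoid"
  where "int_semidirect K N = semidirect N char_group (\<lambda>x. conj_by K (char_map K x))"

text \<open>The pair \<open>(\<sigma>, x)\<close> stands for the internal automorphism \<open>\<sigma> \<rho>\<^sub>x\<close>.\<close>
definition int_prod ::
  "('g::linordered_ab_group_add \<Rightarrow> 'k::field) set \<Rightarrow>
    (('g \<Rightarrow> 'k) \<Rightarrow> 'g \<Rightarrow> 'k) \<times> ('g \<Rightarrow> 'k) \<Rightarrow> ('g \<Rightarrow> 'k) \<Rightarrow> 'g \<Rightarrow> 'k"
  where "int_prod K = (\<lambda>(\<sigma>, x). \<sigma> \<otimes>\<^bsub>v_Aut K\<^esub> char_map K x)"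

text \<open>Conjugation by \<open>\<phi>\<close>, transported along \<^term>\<open>int_prod K\<close> to such pairs.\<close>
definition conj_pair ::
  "('g::linordered_ab_group_add \<Rightarrow> 'k::field) set \<Rightarrow> (('g \<Rightarrow> 'k) \<Rightarrow> 'g \<Rightarrow> 'k) monoid \<Rightarrow>
    (('g \<Rightarrow> 'k) \<Rightarrow> 'g \<Rightarrow> 'k) \<Rightarrow>
    (('g \<Rightarrow> 'k) \<Rightarrow> 'g \<Rightarrow> 'k) \<times> ('g \<Rightarrow> 'k) \<Rightarrow> (('g \<Rightarrow> 'k) \<Rightarrow> 'g \<Rightarrow> 'k) \<times> ('g \<Rightarrow> 'k)"
  where "conj_pair K N \<phi> n =
    inv_into (carrier (int_semidirect K N)) (int_prod K) (conj_by K \<phi> (int_prod K n))"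


section \<open>The canonical section fixes the coefficient field\<close>

lemma ord_Aut_zero: "\<tau> \<in> carrier ord_Aut \<Longrightarrow> \<tau> 0 = 0"
  by (simp add: ord_Aut_def) (metis add_cancel_right_right)

lemma id_in_field_Aut: "id \<in> carrier field_Aut"
  by (simp add: field_Aut_def)

lemma supp_const: "supp (const c) \<subseteq> {0}"
  by (auto simp: supp_def monomial_def)

lemma const_in_hahn_field:
  fixes K :: "('g::linordered_ab_group_add \<Rightarrow> 'k::field) set"
  assumes "hahn_field K"
  shows "const c \<in> K"
proof -
  have ne: "const (1::'k) \<noteq> (\<lambda>_::'g. 0)"
    by (metis monomial_def zero_neq_one)
  have s1: "supp (const (1::'k)) = {0::'g}"
    by (auto simp: supp_def monomial_def)
  have "conv (const c) (const 1) = (const c :: 'g \<Rightarrow> 'k)"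
  proof
    fix g :: 'g
    have "{h. h \<in> supp (const c) \<and> g - h \<in> supp (const (1::'k))} =
        (if g = 0 \<and> c \<noteq> 0 then {0} else {})"
      by (auto simp: s1 supp_def monomial_def)
    then show "conv (const c) (const 1) g = const c g"
      by (simp add: conv_def monomial_def)
  qed
  moreover have "finite (supp (const c :: 'g \<Rightarrow> 'k))"
    by (rule finite_subset[OF supp_const]) simp
  moreover have "wfp_on (supp (const c :: 'g \<Rightarrow> 'k)) (<)"
    using supp_const[of c] unfolding wfp_on_iff_ex_minimal
    by (metis (no_types, lifting) order_less_irrefl singletonD subset_iff ex_in_conv)
  ultimately have "const c \<in> (fraction_series :: ('g \<Rightarrow> 'k) set)"
    unfolding fraction_series_def group_algebra_def hahn_ring_def
    using ne s1 by (auto intro!: bexI[of _ "const 1"])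
  with assms show ?thesis
    by (auto simp: hahn_field_def)
qed

lemma canonical_identifies_ext_k:
  assumes K: "hahn_field K" and can: "canonical_first_lifting K" and ch: "chosen_section K \<Psi>"
  shows "identifies_ext_k K \<Psi>"
proof -
  let ?E = "fix_coeffs (ext_Aut K \<Psi>)"
  have sec: "\<Psi> \<in> hom (field_Aut \<times>\<times> ord_Aut) (v_Aut K)"
      "inj_on \<Psi> (carrier (field_Aut \<times>\<times> ord_Aut))"
    using ch by (auto simp: chosen_section_def lifting_section_def)
  have on_const: "\<Psi> (\<rho>, \<tau>) (const c) = const (\<rho> c)"
    if "\<rho> \<in> carrier field_Aut" "\<tau> \<in> carrier ord_Aut" for \<rho> \<tau> c
  proof -
    have bt: "bij \<tau>" and z: "\<tau> 0 = 0" and r0: "\<rho> 0 = 0"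
      using that ord_Aut_zero[of \<tau>]
      by (auto simp: ord_Aut_def field_Aut_def) (metis add_cancel_right_right)
    have "inv_into UNIV \<tau> g = 0 \<longleftrightarrow> g = 0" for g
      using bt z by (metis bij_inv_eq_iff)
    then show ?thesis
      using that can ch const_in_hahn_field[OF K]
      by (auto simp: chosen_section_def canonical_map_def monomial_def DirProd_def r0 fun_eq_iff)
  qed
  have car: "carrier ?E = (\<lambda>\<tau>. \<Psi> (id, \<tau>)) ` carrier ord_Aut"
  proof (intro equalityI subsetI)
    fix \<sigma> assume "\<sigma> \<in> carrier ?E"
    then obtain \<rho> \<tau> where rt: "\<rho> \<in> carrier field_Aut" "\<tau> \<in> carrier ord_Aut" "\<sigma> = \<Psi> (\<rho>, \<tau>)"
      and fixc: "\<And>c. \<sigma> (const c) = const c"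
      by (auto simp: fix_coeffs_def ext_Aut_def DirProd_def)
    have "\<rho> c = c" for c
      using fixc[of c] on_const[OF rt(1,2), of c] rt(3) by (metis monomial_def)
    then have "\<rho> = id" by auto
    with rt show "\<sigma> \<in> (\<lambda>\<tau>. \<Psi> (id, \<tau>)) ` carrier ord_Aut" by auto
  next
    fix \<sigma> assume "\<sigma> \<in> (\<lambda>\<tau>. \<Psi> (id, \<tau>)) ` carrier ord_Aut"
    then show "\<sigma> \<in> carrier ?E"
      using on_const[OF id_in_field_Aut] id_in_field_Aut
      by (auto simp: fix_coeffs_def ext_Aut_def DirProd_def)
  qed
  have "inj_on (\<lambda>\<tau>. \<Psi> (id, \<tau>)) (carrier ord_Aut)"
    using sec(2) id_in_field_Aut by (auto simp: inj_on_def DirProd_def)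
  moreover have "id \<otimes>\<^bsub>field_Aut\<^esub> id = id"
    by (auto simp: field_Aut_def BijGroup_def Bij_def compose_def)
  then have "\<Psi> (id, \<tau> \<otimes>\<^bsub>ord_Aut\<^esub> \<tau>') = \<Psi> (id, \<tau>) \<otimes>\<^bsub>v_Aut K\<^esub> \<Psi> (id, \<tau>')"
    if "\<tau> \<in> carrier ord_Aut" "\<tau>' \<in> carrier ord_Aut" for \<tau> \<tau>'
  proof -
    have "(id, \<tau>) \<in> carrier (field_Aut \<times>\<times> ord_Aut)" "(id, \<tau>') \<in> carrier (field_Aut \<times>\<times> ord_Aut)"
      using that id_in_field_Aut by (auto simp: DirProd_def)
    from hom_mult[OF sec(1) this] \<open>id \<otimes>\<^bsub>field_Aut\<^esub> id = id\<close> show ?thesis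
      by (metis mult_DirProd)
  qed
  ultimately show ?thesis
    unfolding identifies_ext_k_def iso_def hom_def bij_betw_def
    using car by (auto simp: fix_coeffs_def ext_Aut_def)
qed

end

theory Submission
  imports Defs
begin

text \<open>
  Both isomorphisms come from two nested split extensions. The homomorphism \<open>\<Phi>\<close> from
  \<open>v-Aut K\<close> to \<open>Aut k \<times> o-Aut G\<close> has kernel \<open>IntAut K\<close> and is split by the
  section \<open>\<Psi>\<close>. On \<open>IntAut K\<close>, reading off the leading coefficient of the image of
  each \<open>t\<^sup>g\<close> is a homomorphism onto \<open>Hom (G, k\<^sup>\<times>)\<close>; its kernel is
  \<open>1-Aut K\<close> and \<open>x \<mapsto> \<rho>\<^sub>x\<close> splits it. A split surjection always presents its source
  as the semidirect product of the kernel and the target (\<open>semidirect_split_iso\<close>), so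
  everything rests on these two maps being homomorphisms.

  That is a statement about leading terms (\<open>v_Aut_leading_coeff\<close>). If
  \<open>a = c t\<^sup>g + \<epsilon>\<close> with \<open>v(\<epsilon>) > g\<close>, then
  \<open>\<sigma>(a) = \<sigma>(c) \<sigma>(t\<^sup>g) + \<sigma>(\<epsilon>)\<close>, and \<open>\<sigma>(\<epsilon>)\<close> has value
  \<open>\<sigma>\<^sub>G(v(\<epsilon>)) > \<sigma>\<^sub>G(g)\<close>, so it does not contribute to the coefficient at
  \<open>\<sigma>\<^sub>G(g)\<close>: that coefficient is \<open>\<sigma>\<^sub>k(c)\<close> times the one of \<open>\<sigma>(t\<^sup>g)\<close>. For
  \<open>g = 0\<close> this makes \<open>\<sigma> \<mapsto> \<sigma>\<^sub>k\<close> multiplicative, and for internal \<open>\<sigma>\<close>,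
  where \<open>\<sigma>\<^sub>k\<close> and \<open>\<sigma>\<^sub>G\<close> are identities, it does the same for the leading
  coefficients.

  The second isomorphism arises from the same two extensions, restricted to the
  automorphisms that fix \<open>k\<close>. The maps \<open>\<rho>\<^sub>x\<close> fix \<open>k\<close> because
  \<open>x\<^sup>0 = 1\<close>, and the outer splitting is \<open>\<tau> \<mapsto> \<Psi>(id, \<tau>)\<close>, which lands among
  these automorphisms exactly by the hypothesis on \<open>ExtAut\<^sub>k K\<close>.
\<close>

section \<open>Semidirect products from split surjections\<close>

text \<open>
  The kernel is presented as the image of an injective map \<open>\<theta>\<close>, so that a factor which
  is itself a semidirect product of pairs can be fed in directly. Bijectivity comes from
  writing \<open>a = (a \<otimes> inv (s (\<pi> a))) \<otimes> s (\<pi> a)\<close>. The action has to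
  match conjugation only where the conjugate is already known to lie in the image of
  \<open>\<theta>\<close>, and conjugates of the kernel always do; an action defined through
  \<^const>\<open>inv_into\<close> satisfies this without further work.
  Closure of the product is needed to invert the isomorphism.
\<close>
lemma semidirect_split_iso:
  fixes G (structure)
  assumes G: "group G" and H: "group H" and A: "subgroup A G"
    and \<pi>: "\<pi> \<in> hom (G\<lparr>carrier := A\<rparr>) H"
    and s: "s \<in> hom H (G\<lparr>carrier := A\<rparr>)" and \<pi>s: "\<And>h. h \<in> carrier H \<Longrightarrow> \<pi> (s h) = h"
    and \<theta>: "\<theta> \<in> hom N G" "inj_on \<theta> (carrier N)" "\<theta> ` carrier N = {a \<in> A. \<pi> a = \<one>\<^bsub>H\<^esub>}"
    and N: "\<And>n n'. n \<in> carrier N \<Longrightarrow> n' \<in> carrier N \<Longrightarrow> n \<otimes>\<^bsub>N\<^esub> n' \<in> carrier N"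
    and act: "\<And>h n. h \<in> carrier H \<Longrightarrow> n \<in> carrier N \<Longrightarrow>
        s h \<otimes> \<theta> n \<otimes> inv (s h) \<in> \<theta> ` carrier N \<Longrightarrow>
        act h n \<in> carrier N \<and> \<theta> (act h n) = s h \<otimes> \<theta> n \<otimes> inv (s h)"
  shows "(\<lambda>(n, h). \<theta> n \<otimes> s h) \<in> iso (semidirect N H act) (G\<lparr>carrier := A\<rparr>)"
    and "\<And>p q. p \<in> carrier (semidirect N H act) \<Longrightarrow> q \<in> carrier (semidirect N H act) \<Longrightarrow>
        p \<otimes>\<^bsub>semidirect N H act\<^esub> q \<in> carrier (semidirect N H act)"
proof -
  interpret G: group G by (rule G)
  interpret H: group H by (rule H)
  have AG: "a \<in> A \<Longrightarrow> a \<in> carrier G" for a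
    using subgroup.subset[OF A] by auto
  have Am: "a \<in> A \<Longrightarrow> b \<in> A \<Longrightarrow> a \<otimes> b \<in> A" and Ai: "a \<in> A \<Longrightarrow> inv a \<in> A" for a b
    using A by (auto simp: subgroup.m_closed subgroup.m_inv_closed)
  have sA: "s h \<in> A" and s_mult: "h' \<in> carrier H \<Longrightarrow> s (h \<otimes>\<^bsub>H\<^esub> h') = s h \<otimes> s h'"
    if "h \<in> carrier H" for h h'
    using s that by (auto simp: hom_def)
  have \<pi>H: "\<pi> a \<in> carrier H" and \<pi>_mult: "b \<in> A \<Longrightarrow> \<pi> (a \<otimes> b) = \<pi> a \<otimes>\<^bsub>H\<^esub> \<pi> b" if "a \<in> A" for a b
    using \<pi> that by (auto simp: hom_def)
  have \<pi>_one: "\<pi> \<one> = \<one>\<^bsub>H\<^esub>"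
    using \<pi>_mult[of \<one> \<one>] \<pi>H[of \<one>] subgroup.one_closed[OF A] by (auto simp: H.l_cancel_one)
  have \<pi>_inv: "\<pi> (inv a) = inv\<^bsub>H\<^esub> (\<pi> a)" if "a \<in> A" for a
    using \<pi>_mult[of "inv a" a] that \<pi>H Ai AG \<pi>_one by (metis G.l_inv H.inv_equality)
  have \<theta>A: "\<theta> n \<in> A" and \<pi>\<theta>: "\<pi> (\<theta> n) = \<one>\<^bsub>H\<^esub>" if "n \<in> carrier N" for n
    using \<theta>(3) that by auto
  have \<theta>_mult: "\<theta> (n \<otimes>\<^bsub>N\<^esub> n') = \<theta> n \<otimes> \<theta> n'" if "n \<in> carrier N" "n' \<in> carrier N" for n n'
    using \<theta>(1) that by (auto simp: hom_def)
  have act': "act h n \<in> carrier N \<and> \<theta> (act h n) = s h \<otimes> \<theta> n \<otimes> inv (s h)"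
    if "h \<in> carrier H" "n \<in> carrier N" for h n
  proof (rule act[OF that])
    have "\<pi> (s h \<otimes> \<theta> n \<otimes> inv (s h)) = \<one>\<^bsub>H\<^esub>"
      using that by (simp add: \<pi>_mult \<pi>_inv Am Ai sA \<theta>A \<pi>\<theta> \<pi>s)
    then show "s h \<otimes> \<theta> n \<otimes> inv (s h) \<in> \<theta> ` carrier N"
      using that by (simp add: \<theta>(3) Am Ai sA \<theta>A)
  qed
  let ?f = "\<lambda>(n, h). \<theta> n \<otimes> s h"
  have "?f \<in> hom (semidirect N H act) (G\<lparr>carrier := A\<rparr>)"
  proof (rule homI)
    fix p q assume "p \<in> carrier (semidirect N H act)" "q \<in> carrier (semidirect N H act)"
    then obtain n h n' h' where pq: "p = (n, h)" "q = (n', h')"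
      and m: "n \<in> carrier N" "n' \<in> carrier N" "h \<in> carrier H" "h' \<in> carrier H"
      by (auto simp: semidirect_def)
    have "\<theta> n \<otimes> (s h \<otimes> \<theta> n' \<otimes> inv (s h)) \<otimes> (s h \<otimes> s h') = \<theta> n \<otimes> s h \<otimes> (\<theta> n' \<otimes> s h')"
      using m by (simp add: G.m_assoc AG \<theta>A sA G.inv_solve_left' flip: G.m_assoc[of "inv (s h)" "s h"])
    then show "?f (p \<otimes>\<^bsub>semidirect N H act\<^esub> q) = ?f p \<otimes>\<^bsub>G\<lparr>carrier := A\<rparr>\<^esub> ?f q"
      using m act' by (simp add: pq semidirect_def \<theta>_mult s_mult)
  qed (auto simp: semidirect_def Am \<theta>A sA)
  moreover have "inj_on ?f (carrier (semidirect N H act))"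
  proof (rule inj_onI)
    fix p q assume "p \<in> carrier (semidirect N H act)" "q \<in> carrier (semidirect N H act)"
      and eq: "?f p = ?f q"
    then obtain n h n' h' where pq: "p = (n, h)" "q = (n', h')"
      and m: "n \<in> carrier N" "n' \<in> carrier N" "h \<in> carrier H" "h' \<in> carrier H"
      by (auto simp: semidirect_def)
    have "h = h'"
      using arg_cong[OF eq, of \<pi>] m by (simp add: pq \<pi>_mult \<theta>A sA \<pi>\<theta> \<pi>s)
    moreover from this have "\<theta> n = \<theta> n'"
      using eq m by (simp add: pq AG \<theta>A sA)
    ultimately show "p = q"
      using m \<theta>(2) by (auto simp: pq dest: inj_onD)
  qed
  moreover have "a \<in> ?f ` carrier (semidirect N H act)" if a: "a \<in> A" for a
  proof -
    let ?h = "\<pi> a"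
    have h: "?h \<in> carrier H" using a by (rule \<pi>H)
    have "\<pi> (a \<otimes> inv (s ?h)) = \<one>\<^bsub>H\<^esub>"
      using a h by (simp add: \<pi>_mult \<pi>_inv Ai sA \<pi>s)
    then have "a \<otimes> inv (s ?h) \<in> \<theta> ` carrier N"
      using a h by (simp add: \<theta>(3) Am Ai sA)
    then obtain n where n: "n \<in> carrier N" "\<theta> n = a \<otimes> inv (s ?h)"
      by auto
    then have "?f (n, ?h) = a"
      using a h by (simp add: G.m_assoc AG sA)
    then show ?thesis
      using n h by (force simp: semidirect_def)
  qed
  moreover have "?f p \<in> A" if "p \<in> carrier (semidirect N H act)" for p
    using that by (auto simp: semidirect_def Am \<theta>A sA)
  ultimately show "?f \<in> iso (semidirect N H act) (G\<lparr>carrier := A\<rparr>)"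
    unfolding iso_def bij_betw_def by auto
  show "p \<otimes>\<^bsub>semidirect N H act\<^esub> q \<in> carrier (semidirect N H act)"
    if "p \<in> carrier (semidirect N H act)" "q \<in> carrier (semidirect N H act)" for p q
    using that act' N by (auto simp: semidirect_def)
qed

text \<open>
  Closure takes the place of a group structure on \<open>S\<close>: it is what makes the inverse
  bijection a homomorphism.
\<close>
lemma is_iso_if_iso_from_closed:
  assumes f: "f \<in> iso S A"
    and S: "\<And>p q. p \<in> carrier S \<Longrightarrow> q \<in> carrier S \<Longrightarrow> p \<otimes>\<^bsub>S\<^esub> q \<in> carrier S"
  shows "A \<cong> S"
proof -
  let ?g = "inv_into (carrier S) f"
  have b: "bij_betw f (carrier S) (carrier A)" and h: "f \<in> hom S A"
    using f by (auto simp: iso_def)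
  have inv: "?g a \<in> carrier S" "f (?g a) = a" if "a \<in> carrier A" for a
    using b that by (auto simp: bij_betw_def inv_into_into f_inv_into_f)
  have "?g (a \<otimes>\<^bsub>A\<^esub> b) = ?g a \<otimes>\<^bsub>S\<^esub> ?g b" if "a \<in> carrier A" "b \<in> carrier A" for a b
  proof -
    have "f (?g a \<otimes>\<^bsub>S\<^esub> ?g b) = a \<otimes>\<^bsub>A\<^esub> b"
      using h that inv by (simp add: hom_mult)
    then show ?thesis
      using b S that inv by (metis bij_betw_imp_inj_on inv_into_f_f)
  qed
  then have "?g \<in> iso A S"
    using bij_betw_inv_into[OF b] inv by (auto simp: iso_def hom_def)
  then show ?thesis by (auto simp: is_iso_def)
qed

lemma group_BijGroup_carrier:
  assumes "C \<subseteq> Bij S" "restrict (\<lambda>x. x) S \<in> C"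
    and "\<And>f g. f \<in> C \<Longrightarrow> g \<in> C \<Longrightarrow> compose S f g \<in> C"
    and "\<And>f. f \<in> C \<Longrightarrow> restrict (inv_into S f) S \<in> C"
  shows "group (BijGroup S\<lparr>carrier := C\<rparr>)"
proof -
  interpret B: group "BijGroup S" by (rule group_BijGroup)
  have "subgroup C (BijGroup S)"
  proof (rule subgroup.intro)
    fix x y assume "x \<in> C" "y \<in> C"
    then show "x \<otimes>\<^bsub>BijGroup S\<^esub> y \<in> C"
      using assms by (auto simp: BijGroup_def)
  next
    fix x assume "x \<in> C"
    then show "inv\<^bsub>BijGroup S\<^esub> x \<in> C"
      using assms by (simp add: inv_BijGroup subsetD)
  qed (use assms in \<open>auto simp: BijGroup_def\<close>)
  then show ?thesis by (rule B.subgroup_imp_group)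
qed

section \<open>The groups that appear as factors\<close>

lemma group_field_Aut: "group (field_Aut :: ('k::field \<Rightarrow> 'k) monoid)"
  unfolding field_Aut_def
proof (rule group_BijGroup_carrier)
  let ?C = "{\<rho>::'k \<Rightarrow> 'k. bij \<rho> \<and> \<rho> 1 = 1 \<and>
      (\<forall>c d. \<rho> (c + d) = \<rho> c + \<rho> d \<and> \<rho> (c * d) = \<rho> c * \<rho> d)}"
  show "?C \<subseteq> Bij UNIV" by (auto simp: Bij_def)
  show "restrict (\<lambda>x. x) UNIV \<in> ?C" by (auto simp: bij_def)
  show "compose UNIV f g \<in> ?C" if "f \<in> ?C" "g \<in> ?C" for f g
  proof -
    have "compose UNIV f g = f \<circ> g" by (auto simp: compose_def)
    then show ?thesis using that by (auto simp: bij_comp)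
  qed
  show "restrict (inv_into UNIV f) UNIV \<in> ?C" if "f \<in> ?C" for f
    using that by (auto simp: bij_imp_bij_inv inv_f_eq bij_is_inj bij_is_surj surj_f_inv_f)
qed

lemma strict_mono_ord_Aut: "\<tau> \<in> carrier ord_Aut \<Longrightarrow> strict_mono \<tau>"
  by (auto simp: ord_Aut_def strict_mono_iff_mono bij_is_inj)

lemma inv_in_ord_Aut:
  assumes \<tau>: "\<tau> \<in> carrier ord_Aut"
  shows "inv_into UNIV \<tau> \<in> carrier ord_Aut"
proof -
  have "inv_into UNIV \<tau> g \<le> inv_into UNIV \<tau> h" if "g \<le> h" for g h
  proof -
    have "surj \<tau>" using \<tau> by (simp add: ord_Aut_def bij_is_surj)
    then show ?thesis
      using that strict_mono_ord_Aut[OF \<tau>] by (metis strict_mono_less_eq surj_f_inv_f)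
  qed
  then show ?thesis
    using \<tau> by (auto simp: ord_Aut_def bij_imp_bij_inv inv_f_eq bij_is_inj bij_is_surj surj_f_inv_f mono_def)
qed

lemma group_ord_Aut: "group (ord_Aut :: ('g::linordered_ab_group_add \<Rightarrow> 'g) monoid)"
proof -
  let ?C = "carrier (ord_Aut :: ('g \<Rightarrow> 'g) monoid)"
  have "group (BijGroup UNIV\<lparr>carrier := ?C\<rparr>)"
  proof (rule group_BijGroup_carrier)
    show "?C \<subseteq> Bij UNIV" by (auto simp: ord_Aut_def Bij_def)
    show "restrict (\<lambda>x. x) UNIV \<in> ?C" by (auto simp: ord_Aut_def bij_def mono_def)
    show "compose UNIV f g \<in> ?C" if "f \<in> ?C" "g \<in> ?C" for f g
    proof -
      have "compose UNIV f g = f \<circ> g" by (auto simp: compose_def)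
      then show ?thesis using that by (auto simp: ord_Aut_def bij_comp mono_def)
    qed
    show "restrict (inv_into UNIV f) UNIV \<in> ?C" if "f \<in> ?C" for f
      using inv_in_ord_Aut[OF that] by (simp add: restrict_def)
  qed
  then show ?thesis by (simp add: ord_Aut_def)
qed

lemma group_char_group:
  "group (char_group :: ('g::linordered_ab_group_add \<Rightarrow> 'k::field) monoid)"
proof (rule groupI)
  fix x :: "'g \<Rightarrow> 'k" assume x: "x \<in> carrier char_group"
  then show "\<exists>y \<in> carrier char_group. y \<otimes>\<^bsub>char_group\<^esub> x = \<one>\<^bsub>char_group\<^esub>"
    by (intro bexI[of _ "\<lambda>g. inverse (x g)"]) (auto simp: char_group_def)
qed (auto simp: char_group_def algebra_simps)

lemma char_zero: "x \<in> carrier char_group \<Longrightarrow> x 0 = 1"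
  by (simp add: char_group_def) (metis add_0 mult_cancel_right1)

section \<open>Leading coefficients of Hahn series\<close>

lemma monomial_apply: "monomial c g h = (if h = g then c else 0)"
  by (simp add: monomial_def)

lemma val_tpow: "val (tpow g :: 'g::linorder \<Rightarrow> 'k::zero_neq_one) = g"
  unfolding val_def by (rule Least_equality) (auto simp: supp_def monomial_apply split: if_splits)

lemma tpow_nonzero: "tpow g \<noteq> (\<lambda>_. 0 :: 'k::zero_neq_one)"
  by (metis monomial_apply zero_neq_one)

lemma conv_monomial_left:
  fixes a :: "'g::linordered_ab_group_add \<Rightarrow> 'k::field"
  shows "conv (monomial c g) a = (\<lambda>h. c * a (h - g))"
proof
  fix h
  have "{u. u \<in> supp (monomial c g) \<and> h - u \<in> supp a} =
      (if c \<noteq> 0 \<and> a (h - g) \<noteq> 0 then {g} else {})"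
    by (auto simp: supp_def monomial_apply)
  then show "conv (monomial c g) a h = c * a (h - g)"
    by (simp add: conv_def monomial_apply)
qed

text \<open>
  Lowest terms multiply: under \<open>g \<le> u\<close> and \<open>h \<le> g + h - u\<close> the only
  contribution to the coefficient at \<open>g + h\<close> is \<open>u = g\<close>. Phrasing the assumption as
  vanishing below \<open>g\<close> and \<open>h\<close>, rather than through the valuation, covers zero series
  as well.
\<close>
lemma conv_leading:
  fixes a b :: "'g::linordered_ab_group_add \<Rightarrow> 'k::field"
  assumes "\<And>u. u < g \<Longrightarrow> a u = 0" "\<And>u. u < h \<Longrightarrow> b u = 0"
  shows "conv a b (g + h) = a g * b h"
proof -
  have "u = g" if "a u \<noteq> 0" "b (g + h - u) \<noteq> 0" for u
  proof -
    have "g \<le> u" "h \<le> g + h - u"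
      using that assms by (meson not_le)+
    then show ?thesis by (simp add: algebra_simps)
  qed
  then have "{u. u \<in> supp a \<and> g + h - u \<in> supp b} = (if a g \<noteq> 0 \<and> b h \<noteq> 0 then {g} else {})"
    unfolding supp_def by (force simp: algebra_simps)
  then show ?thesis by (simp add: conv_def)
qed

lemma wfp_on_finite: "finite A \<Longrightarrow> wfp_on A (<)" for A :: "'g::linorder set"
  unfolding wfp_on_iff_ex_minimal
  by (metis Min_in Min_le finite_subset not_le)

text \<open>
  The relation between \<open>\<sigma>\<close> and \<open>\<sigma>\<^sub>G\<close> without the definite description in
  \<^const>\<open>group_part\<close>.
\<close>
definition val_shift ::
  "('g::linordered_ab_group_add \<Rightarrow> 'k::zero) set \<Rightarrow> (('g \<Rightarrow> 'k) \<Rightarrow> 'g \<Rightarrow> 'k) \<Rightarrow> ('g \<Rightarrow> 'g) \<Rightarrow> bool"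
  where "val_shift K \<sigma> \<tau> \<longleftrightarrow>
    \<tau> \<in> carrier ord_Aut \<and> (\<forall>a \<in> K - {\<lambda>_. 0}. \<tau> (val a) = val (\<sigma> a))"

definition leading_char :: "(('g \<Rightarrow> 'k::zero_neq_one) \<Rightarrow> 'g \<Rightarrow> 'k) \<Rightarrow> 'g \<Rightarrow> 'k"
  where "leading_char \<sigma> g = \<sigma> (tpow g) g"

context
  fixes K :: "('g::linordered_ab_group_add \<Rightarrow> 'k::field) set"
  assumes K: "hahn_field K"
begin

text \<open>A finite series is the fraction with denominator 1.\<close>
lemma finite_supp_in_K:
  assumes "finite (supp a)"
  shows "a \<in> K"
proof -
  have s1: "supp (const (1::'k)) = {0::'g}"
    by (auto simp: supp_def monomial_apply)
  have "conv a (const 1) = a"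
  proof
    fix g
    have "{h. h \<in> supp a \<and> g - h \<in> supp (const (1::'k))} = (if a g \<noteq> 0 then {g} else {})"
      unfolding s1 by (auto simp: supp_def)
    then show "conv a (const 1) g = a g"
      by (simp add: conv_def monomial_apply)
  qed
  moreover have "const (1::'k) \<noteq> (\<lambda>_::'g. 0)"
    by (metis monomial_apply zero_neq_one)
  ultimately have "a \<in> fraction_series"
    using assms s1 wfp_on_finite[OF assms]
    by (auto simp: fraction_series_def group_algebra_def hahn_ring_def intro!: bexI[of _ "const 1"])
  with K show ?thesis by (auto simp: hahn_field_def)
qed

lemma monomial_in_K [simp]: "monomial c g \<in> K"
proof (rule finite_supp_in_K)
  have "supp (monomial c g) \<subseteq> {g}" by (auto simp: supp_def monomial_apply)
  then show "finite (supp (monomial c g))" by (rule finite_subset) simp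
qed

lemma zero_in_K: "(\<lambda>_. 0) \<in> K"
  by (rule finite_supp_in_K) (simp add: supp_def)

lemma ring_restricted: "ring (restricted K)"
  using K by (auto simp: hahn_field_def field_def domain_def cring_def)

lemma conv_in_K: "a \<in> K \<Longrightarrow> b \<in> K \<Longrightarrow> conv a b \<in> K"
  using monoid.m_closed[OF ring.is_monoid[OF ring_restricted], of a b] by (simp add: hahn_ring_def)

lemma add_in_K: "a \<in> K \<Longrightarrow> b \<in> K \<Longrightarrow> (\<lambda>g. a g + b g) \<in> K"
  using ring.ring_simprules(1)[OF ring_restricted, of a b] by (simp add: hahn_ring_def)

lemma val_props:
  assumes "a \<in> K" "a \<noteq> (\<lambda>_. 0)"
  shows "a (val a) \<noteq> 0" and "a g \<noteq> 0 \<Longrightarrow> val a \<le> g"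
proof -
  have "wfp_on (supp a) (<)" "supp a \<noteq> {}"
    using K assms by (auto simp: hahn_field_def hahn_ring_def supp_def)
  then obtain z where z: "z \<in> supp a" "\<And>y. y < z \<Longrightarrow> y \<notin> supp a"
    unfolding wfp_on_iff_ex_minimal by blast
  then have "val a = z"
    unfolding val_def by (intro Least_equality) (auto simp: not_le[symmetric])
  with z show "a (val a) \<noteq> 0" and "a g \<noteq> 0 \<Longrightarrow> val a \<le> g"
    by (auto simp: supp_def not_le[symmetric])
qed

section \<open>Valuation preserving automorphisms\<close>

lemma v_Aut_iff:
  "\<sigma> \<in> carrier (v_Aut K) \<longleftrightarrow> \<sigma> \<in> Bij K \<and>
    (\<forall>a \<in> K. \<forall>b \<in> K. \<sigma> (conv a b) = conv (\<sigma> a) (\<sigma> b)) \<and>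
    (\<forall>a \<in> K. \<forall>b \<in> K. \<sigma> (\<lambda>g. a g + b g) = (\<lambda>g. \<sigma> a g + \<sigma> b g)) \<and>
    \<sigma> (const 1) = const 1 \<and> (\<exists>\<tau>. val_shift K \<sigma> \<tau>)"
  by (auto simp: v_Aut_def ring_iso_def ring_hom_def hahn_ring_def Bij_def val_shift_def
      dest: bij_betw_apply)

lemma v_Aut_in_K: "\<sigma> a \<in> K" if "\<sigma> \<in> carrier (v_Aut K)" "a \<in> K" for \<sigma> a
  using that Bij_imp_funcset by (fastforce simp: v_Aut_iff)

lemma v_Aut_zero: "\<sigma> (\<lambda>_. 0) = (\<lambda>_. 0)" if "\<sigma> \<in> carrier (v_Aut K)" for \<sigma>
proof
  fix g
  have "\<forall>a \<in> K. \<forall>b \<in> K. \<sigma> (\<lambda>g. a g + b g) = (\<lambda>g. \<sigma> a g + \<sigma> b g)"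
    using that by (simp add: v_Aut_iff)
  from fun_cong[OF bspec[OF bspec[OF this zero_in_K] zero_in_K], of g]
  show "\<sigma> (\<lambda>_. 0) g = 0"
    unfolding add_0 by (metis add_cancel_right_right)
qed

lemma v_Aut_nonzero: "\<sigma> a \<noteq> (\<lambda>_. 0)" if "\<sigma> \<in> carrier (v_Aut K)" "a \<in> K" "a \<noteq> (\<lambda>_. 0)" for \<sigma> a
proof -
  have "inj_on \<sigma> K" using that(1) by (auto simp: v_Aut_iff Bij_def bij_betw_def)
  then show ?thesis
    using that v_Aut_zero[OF that(1)] zero_in_K by (metis inj_onD)
qed

lemma group_v_Aut: "group (v_Aut K)"
proof -
  have "group (BijGroup K\<lparr>carrier := carrier (v_Aut K)\<rparr>)"
  proof (rule group_BijGroup_carrier)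
    show "carrier (v_Aut K) \<subseteq> Bij K" by (auto simp: v_Aut_def)
    have "val_shift K (restrict (\<lambda>x. x) K) id"
      by (auto simp: val_shift_def ord_Aut_def mono_def)
    then show "restrict (\<lambda>x. x) K \<in> carrier (v_Aut K)"
      by (auto simp: v_Aut_iff id_Bij conv_in_K add_in_K)
  next
    fix f g assume fg: "f \<in> carrier (v_Aut K)" "g \<in> carrier (v_Aut K)"
    then obtain \<tau> \<upsilon> where "val_shift K f \<tau>" "val_shift K g \<upsilon>"
      by (auto simp: v_Aut_iff)
    then have "val_shift K (compose K f g) (\<tau> \<circ> \<upsilon>)"
      using v_Aut_in_K[OF fg(2)] v_Aut_nonzero[OF fg(2)]
      by (auto simp: val_shift_def ord_Aut_def bij_comp mono_def compose_def)
    then show "compose K f g \<in> carrier (v_Aut K)"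
      using fg v_Aut_in_K[OF fg(2)]
      by (auto simp: v_Aut_iff compose_Bij conv_in_K add_in_K compose_eq)
  next
    fix f assume f: "f \<in> carrier (v_Aut K)"
    then obtain \<tau> where t: "val_shift K f \<tau>" and fB: "f \<in> Bij K"
      by (auto simp: v_Aut_iff)
    let ?g = "inv_into K f"
    have gK: "?g a \<in> K" and fg: "f (?g a) = a" if "a \<in> K" for a
      using that fB by (auto simp: Bij_def bij_betw_def inv_into_into f_inv_into_f)
    have gf: "?g (f a) = a" if "a \<in> K" for a
      using that fB by (auto simp: Bij_def bij_betw_def)
    have ot: "\<tau> \<in> carrier ord_Aut" using t by (simp add: val_shift_def)
    have bt: "bij \<tau>" using ot by (simp add: ord_Aut_def)
    note inv_in_ord_Aut[OF ot]
    moreover have "inv_into UNIV \<tau> (val a) = val (?g a)" if "a \<in> K" "a \<noteq> (\<lambda>_. 0)" for a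
    proof -
      have "?g a \<noteq> (\<lambda>_. 0)" using fg[OF that(1)] that(2) v_Aut_zero[OF f] by auto
      then have "\<tau> (val (?g a)) = val a"
        using t gK[OF that(1)] fg[OF that(1)] by (auto simp: val_shift_def)
      then show ?thesis using bt by (metis bij_is_inj inv_f_f)
    qed
    ultimately have "val_shift K (restrict ?g K) (inv_into UNIV \<tau>)"
      by (auto simp: val_shift_def)
    moreover have "?g (conv a b) = conv (?g a) (?g b)"
      "?g (\<lambda>h. a h + b h) = (\<lambda>h. ?g a h + ?g b h)" if "a \<in> K" "b \<in> K" for a b
    proof -
      have "f (conv (?g a) (?g b)) = conv a b" "f (\<lambda>h. ?g a h + ?g b h) = (\<lambda>h. a h + b h)"
        using f that gK fg by (auto simp: v_Aut_iff)
      then show "?g (conv a b) = conv (?g a) (?g b)"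
          "?g (\<lambda>h. a h + b h) = (\<lambda>h. ?g a h + ?g b h)"
        using gf[OF conv_in_K[OF gK gK, OF that]] gf[OF add_in_K[OF gK gK, OF that]] by simp_all
    qed
    moreover have "?g (const 1) = const 1"
      using gf[of "const 1"] f by (simp add: v_Aut_iff)
    ultimately show "restrict ?g K \<in> carrier (v_Aut K)"
      using fB by (auto simp: v_Aut_iff restrict_inv_into_Bij conv_in_K add_in_K)
  qed
  then show ?thesis by (simp add: v_Aut_def)
qed

lemma v_Aut_mult: "(\<sigma> \<otimes>\<^bsub>v_Aut K\<^esub> \<sigma>') a = \<sigma> (\<sigma>' a)"
  if "\<sigma> \<in> carrier (v_Aut K)" "\<sigma>' \<in> carrier (v_Aut K)" "a \<in> K" for \<sigma> \<sigma>' a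
  using that by (simp add: v_Aut_iff) (simp add: v_Aut_def BijGroup_def compose_eq)

lemma v_Aut_one: "\<one>\<^bsub>v_Aut K\<^esub> a = a" if "a \<in> K" for a
  using that by (simp add: v_Aut_def BijGroup_def)

text \<open>Every \<open>g\<close> is the value of \<open>t\<^sup>g\<close>, so \<open>\<sigma>\<close> determines \<open>\<sigma>\<^sub>G\<close>.\<close>
lemma val_shift_unique: "\<tau> = (\<lambda>g. val (\<sigma> (tpow g)))" if "val_shift K \<sigma> \<tau>" for \<sigma> \<tau>
proof
  fix g
  have "\<forall>a \<in> K - {\<lambda>_. 0}. \<tau> (val a) = val (\<sigma> a)"
    using that by (simp add: val_shift_def)
  moreover have "tpow g \<in> K - {\<lambda>_. 0}"
    using tpow_nonzero by simp
  ultimately have "\<tau> (val (tpow g :: 'g \<Rightarrow> 'k)) = val (\<sigma> (tpow g))"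
    by (rule bspec)
  then show "\<tau> g = val (\<sigma> (tpow g))"
    by (simp add: val_tpow)
qed

lemma group_part_eq: "group_part K \<sigma> = \<tau>" if "val_shift K \<sigma> \<tau>" for \<sigma> \<tau>
  unfolding group_part_def val_shift_def[symmetric]
  using that val_shift_unique by blast

lemma val_shift_group_part: "val_shift K \<sigma> (group_part K \<sigma>)" if "\<sigma> \<in> carrier (v_Aut K)" for \<sigma>
  using that group_part_eq by (auto simp: v_Aut_iff)

text \<open>
  Preservation of the valuation in terms of vanishing coefficients, where the zero series
  is not an exception; the second part is the strict inequality \<open>v(a) > g\<close>.
\<close>
lemma v_Aut_vanishing:
  assumes s: "\<sigma> \<in> carrier (v_Aut K)" and a: "a \<in> K" and t: "val_shift K \<sigma> \<tau>"
  shows "(\<And>h. h < g \<Longrightarrow> a h = 0) \<Longrightarrow> h < \<tau> g \<Longrightarrow> \<sigma> a h = 0"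
    and "(\<And>h. h \<le> g \<Longrightarrow> a h = 0) \<Longrightarrow> h \<le> \<tau> g \<Longrightarrow> \<sigma> a h = 0"
proof -
  have *: "\<exists>u. a u \<noteq> 0 \<and> \<tau> u \<le> h" if "\<sigma> a h \<noteq> 0" for h
  proof -
    have nz: "a \<noteq> (\<lambda>_. 0)" using that v_Aut_zero[OF s] by auto
    then have "val (\<sigma> a) \<le> h"
      using val_props(2) s a that v_Aut_in_K v_Aut_nonzero by blast
    then show ?thesis
      using t a nz val_props(1) by (auto simp: val_shift_def intro!: exI[of _ "val a"])
  qed
  have sm: "strict_mono \<tau>" using t strict_mono_ord_Aut by (auto simp: val_shift_def)
  show "\<sigma> a h = 0" if "\<And>h. h < g \<Longrightarrow> a h = 0" "h < \<tau> g"
    using * that sm by (metis le_less_trans strict_mono_less)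
  show "\<sigma> a h = 0" if "\<And>h. h \<le> g \<Longrightarrow> a h = 0" "h \<le> \<tau> g"
    using * that sm by (metis order_trans strict_mono_less_eq)
qed

lemma v_Aut_const_negative:
  assumes s: "\<sigma> \<in> carrier (v_Aut K)" and "h < 0"
  shows "\<sigma> (const c) h = 0"
proof -
  have t: "val_shift K \<sigma> (group_part K \<sigma>)" by (rule val_shift_group_part[OF s])
  then have "group_part K \<sigma> 0 = 0" by (simp add: val_shift_def ord_Aut_zero)
  with assms(2) show ?thesis
    by (intro v_Aut_vanishing(1)[OF s monomial_in_K t, where g = 0]) (auto simp: monomial_apply)
qed

text \<open>
  The key computation: split off the lowest term of \<open>a\<close>; the image of the remainder has
  value above \<open>\<tau> g\<close>.
\<close>
lemma v_Aut_leading_coeff: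
  assumes s: "\<sigma> \<in> carrier (v_Aut K)" and a: "a \<in> K" and t: "val_shift K \<sigma> \<tau>"
    and low: "\<And>h. h < g \<Longrightarrow> a h = 0"
  shows "\<sigma> a (\<tau> g) = coeff_part \<sigma> (a g) * \<sigma> (tpow g) (\<tau> g)"
proof -
  define e where "e = (\<lambda>h. a h + monomial (- a g) g h)"
  have e: "e \<in> K" "\<And>h. h \<le> g \<Longrightarrow> e h = 0"
    using add_in_K[OF a monomial_in_K] low by (auto simp: e_def monomial_apply order_le_less)
  have "a = (\<lambda>h. conv (const (a g)) (tpow g) h + e h)"
    by (auto simp: e_def conv_monomial_left monomial_apply)
  then have "\<sigma> a = \<sigma> (\<lambda>h. conv (const (a g)) (tpow g) h + e h)" by simp
  also have "\<dots> = (\<lambda>h. conv (\<sigma> (const (a g))) (\<sigma> (tpow g)) h + \<sigma> e h)"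
    using s e(1) by (simp add: v_Aut_iff conv_in_K)
  finally have "\<sigma> a (\<tau> g) = conv (\<sigma> (const (a g))) (\<sigma> (tpow g)) (0 + \<tau> g) + \<sigma> e (\<tau> g)"
    by simp
  also have "\<sigma> e (\<tau> g) = 0"
    using v_Aut_vanishing(2)[OF s e(1) t e(2)] by simp
  also have "conv (\<sigma> (const (a g))) (\<sigma> (tpow g)) (0 + \<tau> g) = \<sigma> (const (a g)) 0 * \<sigma> (tpow g) (\<tau> g)"
  proof (rule conv_leading)
    show "\<sigma> (tpow g) u = 0" if "u < \<tau> g" for u
      using v_Aut_vanishing(1)[OF s _ t, of "tpow g" g u] that by (simp add: monomial_apply)
  qed (rule v_Aut_const_negative[OF s])
  finally show ?thesis by (simp add: coeff_part_def)
qed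

text \<open>
  On the valuation ring, \<open>\<sigma>\<close> induces \<open>\<sigma>\<^sub>k\<close> on the residue field. This gives
  multiplicativity of \<open>\<sigma> \<mapsto> \<sigma>\<^sub>k\<close>, although \<open>\<sigma>\<close> need not map \<open>k\<close> to itself.
\<close>
lemma coeff_part_leading:
  assumes s: "\<sigma> \<in> carrier (v_Aut K)" and a: "a \<in> K" and low: "\<And>h. h < 0 \<Longrightarrow> a h = 0"
  shows "\<sigma> a 0 = coeff_part \<sigma> (a 0)"
proof -
  have t: "val_shift K \<sigma> (group_part K \<sigma>)" by (rule val_shift_group_part[OF s])
  then have "group_part K \<sigma> 0 = 0" by (simp add: val_shift_def ord_Aut_zero)
  moreover have "\<sigma> (const 1) = const 1" using s by (simp add: v_Aut_iff)
  ultimately show ?thesis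
    using v_Aut_leading_coeff[OF s a t, of 0] low by (simp add: monomial_apply)
qed

lemma coeff_part_mult:
  assumes "\<sigma> \<in> carrier (v_Aut K)" "\<sigma>' \<in> carrier (v_Aut K)"
  shows "coeff_part (\<sigma> \<otimes>\<^bsub>v_Aut K\<^esub> \<sigma>') = coeff_part \<sigma> \<circ> coeff_part \<sigma>'"
proof
  fix c
  have "\<sigma> (\<sigma>' (const c)) 0 = coeff_part \<sigma> (\<sigma>' (const c) 0)"
    using assms by (intro coeff_part_leading) (auto simp: v_Aut_in_K v_Aut_const_negative)
  then show "coeff_part (\<sigma> \<otimes>\<^bsub>v_Aut K\<^esub> \<sigma>') c = (coeff_part \<sigma> \<circ> coeff_part \<sigma>') c"
    using assms by (simp add: coeff_part_def v_Aut_mult)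
qed

lemma coeff_part_in_field_Aut:
  assumes s: "\<sigma> \<in> carrier (v_Aut K)"
  shows "coeff_part \<sigma> \<in> carrier field_Aut"
proof -
  interpret V: group "v_Aut K" by (rule group_v_Aut)
  \<comment> \<open>Bijectivity follows from multiplicativity: the inverse automorphism induces the inverse map.\<close>
  have "coeff_part \<one>\<^bsub>v_Aut K\<^esub> = id"
    by (auto simp: coeff_part_def v_Aut_one monomial_apply)
  then have "coeff_part \<sigma> \<circ> coeff_part (inv\<^bsub>v_Aut K\<^esub> \<sigma>) = id"
    "coeff_part (inv\<^bsub>v_Aut K\<^esub> \<sigma>) \<circ> coeff_part \<sigma> = id"
    using s by (simp_all flip: coeff_part_mult)
  then have "bij (coeff_part \<sigma>)" by (metis o_bij)
  moreover have "coeff_part \<sigma> 1 = 1"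
    using s by (simp add: coeff_part_def v_Aut_iff monomial_apply)
  moreover have "coeff_part \<sigma> (c + d) = coeff_part \<sigma> c + coeff_part \<sigma> d" for c d
  proof -
    have "const (c + d) = (\<lambda>g::'g. const c g + const d g)" by (auto simp: monomial_apply)
    then have "\<sigma> (const (c + d)) = \<sigma> (\<lambda>g. const c g + const d g)" by simp
    also have "\<dots> = (\<lambda>g. \<sigma> (const c) g + \<sigma> (const d) g)"
      using s by (simp add: v_Aut_iff)
    finally show ?thesis by (simp add: coeff_part_def)
  qed
  moreover have "coeff_part \<sigma> (c * d) = coeff_part \<sigma> c * coeff_part \<sigma> d" for c d
  proof -
    have "const (c * d) = conv (const c) (const d :: 'g \<Rightarrow> 'k)"
      by (auto simp: conv_monomial_left monomial_apply)
    then have "\<sigma> (const (c * d)) = conv (\<sigma> (const c)) (\<sigma> (const d))"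
      using s by (simp add: v_Aut_iff)
    then show ?thesis
      using conv_leading[of 0 "\<sigma> (const c)" 0 "\<sigma> (const d)"] v_Aut_const_negative[OF s]
      by (simp add: coeff_part_def)
  qed
  ultimately show ?thesis by (simp add: field_Aut_def)
qed

lemma group_part_mult:
  assumes s: "\<sigma> \<in> carrier (v_Aut K)" "\<sigma>' \<in> carrier (v_Aut K)"
  shows "group_part K (\<sigma> \<otimes>\<^bsub>v_Aut K\<^esub> \<sigma>') = group_part K \<sigma> \<circ> group_part K \<sigma>'"
proof (rule group_part_eq)
  show "val_shift K (\<sigma> \<otimes>\<^bsub>v_Aut K\<^esub> \<sigma>') (group_part K \<sigma> \<circ> group_part K \<sigma>')"
    using val_shift_group_part[OF s(1)] val_shift_group_part[OF s(2)] s
    by (auto simp: val_shift_def ord_Aut_def bij_comp mono_def v_Aut_mult v_Aut_in_K v_Aut_nonzero)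
qed

lemma Phi_hom: "Phi K \<in> hom (v_Aut K) (field_Aut \<times>\<times> ord_Aut)"
proof (rule homI)
  fix \<sigma> assume s: "\<sigma> \<in> carrier (v_Aut K)"
  show "Phi K \<sigma> \<in> carrier (field_Aut \<times>\<times> ord_Aut)"
    using coeff_part_in_field_Aut[OF s] val_shift_group_part[OF s]
    by (simp add: Phi_def DirProd_def val_shift_def)
  fix \<sigma>' assume s': "\<sigma>' \<in> carrier (v_Aut K)"
  have 1: "coeff_part \<sigma> \<in> Bij UNIV" "coeff_part \<sigma>' \<in> Bij UNIV"
    using coeff_part_in_field_Aut s s' by (auto simp: field_Aut_def Bij_def)
  have 2: "group_part K \<sigma> \<in> Bij UNIV" "group_part K \<sigma>' \<in> Bij UNIV"
    using val_shift_group_part s s' by (auto simp: val_shift_def ord_Aut_def Bij_def)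
  show "Phi K (\<sigma> \<otimes>\<^bsub>v_Aut K\<^esub> \<sigma>') = Phi K \<sigma> \<otimes>\<^bsub>field_Aut \<times>\<times> ord_Aut\<^esub> Phi K \<sigma>'"
    using 1 2 s s'
    by (simp add: Phi_def coeff_part_mult group_part_mult)
       (simp add: field_Aut_def ord_Aut_def BijGroup_def compose_def comp_def restrict_def)
qed

section \<open>Internal automorphisms\<close>

lemma int_Aut_iff:
  "\<sigma> \<in> carrier (int_Aut K) \<longleftrightarrow>
    \<sigma> \<in> carrier (v_Aut K) \<and> coeff_part \<sigma> = id \<and> val_shift K \<sigma> id"
proof -
  have "\<one>\<^bsub>field_Aut\<^esub> = (id :: 'k \<Rightarrow> 'k)" "\<one>\<^bsub>ord_Aut\<^esub> = (id :: 'g \<Rightarrow> 'g)"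
    by (auto simp: field_Aut_def ord_Aut_def BijGroup_def)
  then show ?thesis
    using val_shift_group_part[of \<sigma>] group_part_eq[of \<sigma> id]
    by (auto simp: int_Aut_def kernel_def Phi_def)
qed

lemma group_field_ord: "group ((field_Aut :: ('k \<Rightarrow> 'k) monoid) \<times>\<times> (ord_Aut :: ('g \<Rightarrow> 'g) monoid))"
  by (intro DirProd_group group_field_Aut group_ord_Aut)

lemma subgroup_int_Aut: "subgroup (carrier (int_Aut K)) (v_Aut K)"
proof -
  interpret group_hom "v_Aut K" "field_Aut \<times>\<times> ord_Aut" "Phi K"
    by (intro group_hom.intro group_hom_axioms.intro group_v_Aut group_field_ord Phi_hom)
  show ?thesis using subgroup_kernel by (simp add: int_Aut_def)
qed

lemma subgroup_fixing:
  assumes B: "subgroup B (v_Aut K)"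
  shows "subgroup {\<sigma> \<in> B. \<forall>c. \<sigma> (const c) = const c} (v_Aut K)"
proof -
  interpret V: group "v_Aut K" by (rule group_v_Aut)
  have BV: "\<sigma> \<in> B \<Longrightarrow> \<sigma> \<in> carrier (v_Aut K)" for \<sigma>
    using subgroup.subset[OF B] by auto
  have "(inv\<^bsub>v_Aut K\<^esub> \<sigma>) (const c) = const c"
    if "\<sigma> \<in> carrier (v_Aut K)" "\<sigma> (const c) = const c" for \<sigma> c
  proof -
    have "(inv\<^bsub>v_Aut K\<^esub> \<sigma>) (\<sigma> (const c)) = const c"
      using that(1) by (metis V.inv_closed V.l_inv monomial_in_K v_Aut_mult v_Aut_one)
    with that(2) show ?thesis by simp
  qed
  then show ?thesis
    using B BV by (auto intro!: V.subgroupI simp: subgroup.m_closed subgroup.m_inv_closed v_Aut_mult v_Aut_one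
        intro!: exI[of _ "\<one>\<^bsub>v_Aut K\<^esub>"] subgroup.one_closed)
qed

lemma int_Aut_leading:
  assumes "\<sigma> \<in> carrier (int_Aut K)" "a \<in> K" "\<And>h. h < g \<Longrightarrow> a h = 0"
  shows "\<sigma> a g = a g * leading_char \<sigma> g"
  using v_Aut_leading_coeff[of \<sigma> a id g] assms by (simp add: int_Aut_iff leading_char_def)

lemma int_Aut_tpow_low: "\<sigma> (tpow g) h = 0" if "\<sigma> \<in> carrier (int_Aut K)" "h < g" for \<sigma> g h
  using v_Aut_vanishing(1)[of \<sigma> "tpow g" id g h] that by (auto simp add: int_Aut_iff monomial_apply)

text \<open>
  For fixed \<open>\<sigma>\<close>, multiplicativity in \<open>g\<close> is multiplicativity of lowest terms;
  in \<open>\<sigma>\<close> it is \<open>int_Aut_leading\<close> applied to \<open>\<sigma>'(t\<^sup>g)\<close>.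
\<close>
lemma leading_char_hom: "leading_char \<in> hom (int_Aut K) char_group"
proof (rule homI)
  fix \<sigma> assume s: "\<sigma> \<in> carrier (int_Aut K)"
  then have sv: "\<sigma> \<in> carrier (v_Aut K)" and t: "val_shift K \<sigma> id" by (auto simp: int_Aut_iff)
  have "leading_char \<sigma> g \<noteq> 0" for g
  proof -
    have "val (\<sigma> (tpow g)) = g" using val_shift_unique[OF t] by (metis id_apply)
    then show ?thesis
      using val_props(1)[of "\<sigma> (tpow g)"] v_Aut_in_K[OF sv] v_Aut_nonzero[OF sv _ tpow_nonzero]
      by (metis leading_char_def monomial_in_K)
  qed
  moreover have "leading_char \<sigma> (g + h) = leading_char \<sigma> g * leading_char \<sigma> h" for g h
  proof -
    have "tpow (g + h) = conv (tpow g) (tpow h :: 'g \<Rightarrow> 'k)"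
      by (auto simp: conv_monomial_left monomial_apply algebra_simps)
    then have "\<sigma> (tpow (g + h)) = conv (\<sigma> (tpow g)) (\<sigma> (tpow h))"
      using sv by (simp add: v_Aut_iff)
    then show ?thesis
      by (simp add: leading_char_def conv_leading int_Aut_tpow_low[OF s])
  qed
  ultimately show "leading_char \<sigma> \<in> carrier char_group" by (simp add: char_group_def)
next
  fix \<sigma> \<sigma>' assume s: "\<sigma> \<in> carrier (int_Aut K)" "\<sigma>' \<in> carrier (int_Aut K)"
  then have sv: "\<sigma> \<in> carrier (v_Aut K)" "\<sigma>' \<in> carrier (v_Aut K)" by (auto simp: int_Aut_iff)
  have "\<sigma> (\<sigma>' (tpow g)) g = \<sigma>' (tpow g) g * leading_char \<sigma> g" for g
    using s sv by (intro int_Aut_leading) (auto simp: v_Aut_in_K int_Aut_tpow_low)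
  moreover have "(\<sigma> \<otimes>\<^bsub>int_Aut K\<^esub> \<sigma>') (tpow g) = \<sigma> (\<sigma>' (tpow g))" for g
    using v_Aut_mult[OF sv, of "tpow g"] by (simp add: int_Aut_def)
  ultimately show "leading_char (\<sigma> \<otimes>\<^bsub>int_Aut K\<^esub> \<sigma>') = leading_char \<sigma> \<otimes>\<^bsub>char_group\<^esub> leading_char \<sigma>'"
    by (simp add: leading_char_def fun_eq_iff char_group_def mult.commute)
qed

lemma char_map_monomial: "char_map K x (monomial c g) = monomial (c * x g) g"
  by (auto simp: char_map_def monomial_apply)

lemma leading_char_char_map: "leading_char (char_map K x) = x"
  by (auto simp: leading_char_def char_map_monomial monomial_apply)

lemma char_map_const: "x \<in> carrier char_group \<Longrightarrow> char_map K x (const c) = const c"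
  by (simp add: char_map_monomial char_zero)

section \<open>The two extensions\<close>

text \<open>
  The inner extension, for a subgroup \<open>A\<close> of \<open>IntAut K\<close> containing all \<open>\<rho>\<^sub>x\<close>:
  it serves both \<open>IntAut K\<close> and its subgroup of automorphisms fixing \<open>k\<close>.
\<close>
lemma int_semidirect_iso:
  assumes A: "subgroup A (v_Aut K)" "A \<subseteq> carrier (int_Aut K)"
    and c2: "canonical_second_lifting K"
    and cA: "\<And>x. x \<in> carrier char_group \<Longrightarrow> char_map K x \<in> A"
    and N: "carrier N = {\<sigma> \<in> A. \<forall>g. \<sigma> (tpow g) g = 1}" "mult N = mult (v_Aut K)"
  shows "int_prod K \<in> iso (int_semidirect K N) ((v_Aut K)\<lparr>carrier := A\<rparr>)"
    and "\<And>p q. p \<in> carrier (int_semidirect K N) \<Longrightarrow> q \<in> carrier (int_semidirect K N) \<Longrightarrow>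
        p \<otimes>\<^bsub>int_semidirect K N\<^esub> q \<in> carrier (int_semidirect K N)"
proof -
  interpret C: group "char_group :: ('g \<Rightarrow> 'k) monoid" by (rule group_char_group)
  have AV: "\<sigma> \<in> A \<Longrightarrow> \<sigma> \<in> carrier (v_Aut K)" for \<sigma>
    using subgroup.subset[OF A(1)] by auto
  have \<pi>: "leading_char \<in> hom ((v_Aut K)\<lparr>carrier := A\<rparr>) char_group"
    using leading_char_hom A(2) by (auto simp: hom_def int_Aut_def)
  have s: "char_map K \<in> hom char_group ((v_Aut K)\<lparr>carrier := A\<rparr>)"
    using c2 cA by (auto simp: hom_def int_Aut_def canonical_second_lifting_def)
  have N1: "carrier N = {\<sigma> \<in> A. leading_char \<sigma> = \<one>\<^bsub>char_group\<^esub>}"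
    by (simp add: N(1) leading_char_def char_group_def fun_eq_iff)
  have cl: "n \<otimes>\<^bsub>N\<^esub> n' \<in> carrier N" if "n \<in> carrier N" "n' \<in> carrier N" for n n'
    using that \<pi> C.one_closed
    by (auto simp: N1 N(2) hom_def subgroup.m_closed[OF A(1)])
  have \<pi>s: "leading_char (char_map K x) = x" if "x \<in> carrier char_group" for x
    by (rule leading_char_char_map)
  note * = semidirect_split_iso[where \<theta> = id and N = N and \<pi> = leading_char
      and s = "char_map K" and act = "\<lambda>x. conj_by K (char_map K x)",
      OF group_v_Aut group_char_group A(1) \<pi> s \<pi>s]
  have id: "id \<in> hom N (v_Aut K)" by (auto simp: hom_def N AV)
  have eq: "int_prod K = (\<lambda>(n, h). id n \<otimes>\<^bsub>v_Aut K\<^esub> char_map K h)"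
    by (auto simp: int_prod_def)
  show "int_prod K \<in> iso (int_semidirect K N) ((v_Aut K)\<lparr>carrier := A\<rparr>)"
    unfolding eq int_semidirect_def
    by (rule *(1)) (use id N1 cl in \<open>auto simp: conj_by_def\<close>)
  show "p \<otimes>\<^bsub>int_semidirect K N\<^esub> q \<in> carrier (int_semidirect K N)"
    if "p \<in> carrier (int_semidirect K N)" "q \<in> carrier (int_semidirect K N)" for p q
    using that unfolding int_semidirect_def
    by (rule *(2)[rotated -2]) (use id N1 cl in \<open>auto simp: conj_by_def\<close>)
qed

text \<open>
  The outer extension, with the kernel \<open>B\<close> in its form as a semidirect product. The
  quotient \<open>H\<close> is \<open>Aut k \<times> o-Aut G\<close>, or \<open>o-Aut G\<close> for automorphisms fixing \<open>k\<close>.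
\<close>
lemma outer_semidirect_iso:
  assumes iso: "int_prod K \<in> iso (int_semidirect K N) ((v_Aut K)\<lparr>carrier := B\<rparr>)"
    and cl: "\<And>p q. p \<in> carrier (int_semidirect K N) \<Longrightarrow> q \<in> carrier (int_semidirect K N) \<Longrightarrow>
        p \<otimes>\<^bsub>int_semidirect K N\<^esub> q \<in> carrier (int_semidirect K N)"
    and H: "group H" and A: "subgroup A (v_Aut K)"
    and \<pi>: "\<pi> \<in> hom ((v_Aut K)\<lparr>carrier := A\<rparr>) H"
    and s: "s \<in> hom H ((v_Aut K)\<lparr>carrier := A\<rparr>)" "\<And>h. h \<in> carrier H \<Longrightarrow> \<pi> (s h) = h"
    and B: "B = {a \<in> A. \<pi> a = \<one>\<^bsub>H\<^esub>}"
  shows "(v_Aut K)\<lparr>carrier := A\<rparr> \<cong>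
    semidirect (int_semidirect K N) H (\<lambda>h. conj_pair K N (s h))"
proof -
  have \<theta>: "int_prod K \<in> hom (int_semidirect K N) (v_Aut K)"
    "inj_on (int_prod K) (carrier (int_semidirect K N))"
    and im: "int_prod K ` carrier (int_semidirect K N) = B"
    using iso B subgroup.subset[OF A] by (auto simp: iso_def hom_def bij_betw_def)
  have act: "conj_pair K N (s h) n \<in> carrier (int_semidirect K N) \<and>
      int_prod K (conj_pair K N (s h) n) = s h \<otimes>\<^bsub>v_Aut K\<^esub> int_prod K n \<otimes>\<^bsub>v_Aut K\<^esub> inv\<^bsub>v_Aut K\<^esub> (s h)"
    if "h \<in> carrier H" "n \<in> carrier (int_semidirect K N)"
      "s h \<otimes>\<^bsub>v_Aut K\<^esub> int_prod K n \<otimes>\<^bsub>v_Aut K\<^esub> inv\<^bsub>v_Aut K\<^esub> (s h)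
        \<in> int_prod K ` carrier (int_semidirect K N)" for h n
    using that(3) unfolding conj_pair_def conj_by_def by (metis inv_into_into f_inv_into_f)
  note * = semidirect_split_iso[where \<pi> = \<pi> and s = s and \<theta> = "int_prod K"
      and act = "\<lambda>h. conj_pair K N (s h)",
      OF group_v_Aut H A \<pi> s \<theta> im[unfolded B] cl act]
  show ?thesis
    by (rule is_iso_if_iso_from_closed[OF *])
qed

lemma v_Aut_semidirect:
  assumes sec: "lifting_section K \<Psi>" and c2: "canonical_second_lifting K"
  shows "v_Aut K \<cong> semidirect (int_semidirect K (one_Aut K)) (field_Aut \<times>\<times> ord_Aut)
        (\<lambda>p. conj_pair K (one_Aut K) (\<Psi> p))"
proof -
  interpret V: group "v_Aut K" by (rule group_v_Aut)
  note int = int_semidirect_iso[OF subgroup_int_Aut order_refl c2, of "one_Aut K"]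
  have cm: "char_map K x \<in> carrier (int_Aut K)" if "x \<in> carrier char_group" for x
    using c2 that by (auto simp: canonical_second_lifting_def hom_def)
  have "(v_Aut K)\<lparr>carrier := carrier (v_Aut K)\<rparr> \<cong>
      semidirect (int_semidirect K (one_Aut K)) (field_Aut \<times>\<times> ord_Aut)
        (\<lambda>p. conj_pair K (one_Aut K) (\<Psi> p))"
  proof (rule outer_semidirect_iso[OF int group_field_ord V.subgroup_self])
    show "Phi K \<in> hom ((v_Aut K)\<lparr>carrier := carrier (v_Aut K)\<rparr>) (field_Aut \<times>\<times> ord_Aut)"
      using Phi_hom by simp
    show "carrier (int_Aut K) = {a \<in> carrier (v_Aut K). Phi K a = \<one>\<^bsub>field_Aut \<times>\<times> ord_Aut\<^esub>}"
      by (simp add: int_Aut_def kernel_def)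
  qed (use sec cm in \<open>auto simp: lifting_section_def one_Aut_def\<close>)
  then show ?thesis by simp
qed

text \<open>
  An automorphism fixing \<open>k\<close> has trivial \<open>\<sigma>\<^sub>k\<close>, so \<open>\<sigma> \<mapsto> \<sigma>\<^sub>G\<close> alone has the
  internal ones among them as its kernel.
\<close>
lemma v_Aut_fixing_semidirect:
  assumes sec: "lifting_section K \<Psi>" and c2: "canonical_second_lifting K"
    and idk: "identifies_ext_k K \<Psi>"
  shows "fix_coeffs (v_Aut K) \<cong>
        semidirect (int_semidirect K (fix_coeffs (one_Aut K))) ord_Aut
          (\<lambda>\<tau>. conj_pair K (fix_coeffs (one_Aut K)) (\<Psi> (id, \<tau>)))"
proof -
  interpret V: group "v_Aut K" by (rule group_v_Aut)
  let ?fixing = "\<lambda>B. {\<sigma> \<in> B. \<forall>c. \<sigma> (const c) = const c}"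
  have cm: "char_map K x \<in> ?fixing (carrier (int_Aut K))" if "x \<in> carrier char_group" for x
    using c2 that char_map_const by (auto simp: canonical_second_lifting_def hom_def)
  have int: "int_prod K \<in> iso (int_semidirect K (fix_coeffs (one_Aut K)))
        ((v_Aut K)\<lparr>carrier := ?fixing (carrier (int_Aut K))\<rparr>)"
    "\<And>p q. p \<in> carrier (int_semidirect K (fix_coeffs (one_Aut K))) \<Longrightarrow>
        q \<in> carrier (int_semidirect K (fix_coeffs (one_Aut K))) \<Longrightarrow>
        p \<otimes>\<^bsub>int_semidirect K (fix_coeffs (one_Aut K))\<^esub> q
          \<in> carrier (int_semidirect K (fix_coeffs (one_Aut K)))"
    by (rule int_semidirect_iso[OF subgroup_fixing[OF subgroup_int_Aut] _ c2];
        use cm in \<open>force simp: fix_coeffs_def one_Aut_def\<close>)+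
  have "(v_Aut K)\<lparr>carrier := ?fixing (carrier (v_Aut K))\<rparr> \<cong>
      semidirect (int_semidirect K (fix_coeffs (one_Aut K))) ord_Aut
          (\<lambda>\<tau>. conj_pair K (fix_coeffs (one_Aut K)) (\<Psi> (id, \<tau>)))"
  proof (rule outer_semidirect_iso[OF int group_ord_Aut subgroup_fixing[OF V.subgroup_self]])
    show "group_part K \<in> hom ((v_Aut K)\<lparr>carrier := ?fixing (carrier (v_Aut K))\<rparr>) ord_Aut"
      using Phi_hom by (auto simp: hom_def Phi_def DirProd_def)
    show "(\<lambda>\<tau>. \<Psi> (id, \<tau>)) \<in> hom ord_Aut ((v_Aut K)\<lparr>carrier := ?fixing (carrier (v_Aut K))\<rparr>)"
    proof -
      have "\<Psi> p \<in> carrier (v_Aut K)" if "p \<in> carrier (field_Aut \<times>\<times> ord_Aut)" for p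
        using sec that by (auto simp: lifting_section_def hom_def)
      then show ?thesis
        using idk by (auto simp: identifies_ext_k_def iso_def hom_def fix_coeffs_def ext_Aut_def Pi_iff)
    qed
    show "group_part K (\<Psi> (id, \<tau>)) = \<tau>" if "\<tau> \<in> carrier ord_Aut" for \<tau>
    proof -
      have "Phi K (\<Psi> (id, \<tau>)) = (id, \<tau>)"
        using sec that id_in_field_Aut by (auto simp: lifting_section_def DirProd_def)
      then show ?thesis by (simp add: Phi_def)
    qed
    have "coeff_part \<sigma> = id" if "\<forall>c. \<sigma> (const c) = const c" for \<sigma> :: "('g \<Rightarrow> 'k) \<Rightarrow> 'g \<Rightarrow> 'k"
      using that by (auto simp: coeff_part_def monomial_apply)
    moreover have "\<one>\<^bsub>ord_Aut\<^esub> = (id :: 'g \<Rightarrow> 'g)"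
      by (auto simp: ord_Aut_def BijGroup_def)
    ultimately show "?fixing (carrier (int_Aut K)) =
        {a \<in> ?fixing (carrier (v_Aut K)). group_part K a = \<one>\<^bsub>ord_Aut\<^esub>}"
      using val_shift_group_part group_part_eq by (auto simp: int_Aut_iff) (metis)
  qed
  then show ?thesis by (simp add: fix_coeffs_def)
qed

end

theorem theorem3p7p1:
  fixes K :: "('g::linordered_ab_group_add \<Rightarrow> 'k::field) set"
    and \<Psi> :: "('g, 'k) section_map"
  assumes "hahn_field K"
    and "chosen_section K \<Psi>"
    and "canonical_second_lifting K"
  shows "v_Aut K \<cong>
      semidirect (int_semidirect K (one_Aut K)) (field_Aut \<times>\<times> ord_Aut)
        (\<lambda>p. conj_pair K (one_Aut K) (\<Psi> p)) \<and>
    (identifies_ext_k K \<Psi> \<longrightarrow>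
      fix_coeffs (v_Aut K) \<cong>
        semidirect (int_semidirect K (fix_coeffs (one_Aut K))) ord_Aut
          (\<lambda>\<tau>. conj_pair K (fix_coeffs (one_Aut K)) (\<Psi> (id, \<tau>))))"
  using v_Aut_semidirect v_Aut_fixing_semidirect assms unfolding chosen_section_def by blast

end
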